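(* Let $a_1,a_2,a_3,a_4,b_1,b_2,b_3,b_4>0$ be positive real numbers such that $$a_1+a_2+a_3+a_4\le b_1+b_2+b_3+b_4,$$ $$a_1a_2+a_1a_3+a_2a_3+a_1a_4+a_2a_4+a_3a_4\le b_1b_2+b_1b_3+b_2b_3+b_1b_4+b_2b_4+b_3b_4,$$ $$a_1a_2a_3+a_1a_2a_4+a_2a_3a_4+a_1a_3a_4\le b_1b_2b_3+b_1b_2b_4+b_2b_3b_4+b_1b_3b_4,$$ $$a_1a_2a_3a_4=b_1b_2b_3b_4.$$ Then $$\log^2a_1+\log^2a_2+\log^2a_3+\log^2a_4\le\log^2b_1+\log^2b_2+\log^2b_3+\log^2b_4.$$
   Context: $\log$ denotes the natural logarithm and $\log^2 x=(\log x)^2$. *)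

theory Defs imports Complex_Main begin

end

theory Submission imports Defs "HOL-Analysis.Interval_Integral" begin

text \<open>
  The hypotheses give \<open>P\<^sub>a(t) = \<Prod>i. (t + a\<^sub>i) \<le> \<Prod>i. (t + b\<^sub>i) = P\<^sub>b(t)\<close> for all \<open>t > 0\<close>, with
  equality of the constant and leading coefficients. Integrating the difference of the logarithms,
  one finds
  \<open>\<integral>\<^sub>0\<^sup>\<infinity> (ln P\<^sub>b(t) - ln P\<^sub>a(t)) / t dt = (\<Sum>i. (ln b\<^sub>i)\<^sup>2 - (ln a\<^sub>i)\<^sup>2) / 2\<close>.
  The integral is handled in the variable \<open>ln t\<close> over \<open>[-L, L]\<close>, by means of an
  antiderivative \<open>H\<close> of \<open>ln (1 + exp u)\<close>.
\<close>

text \<open>Continuity alone gives existence. \<open>H\<close> is not elementary (up to a constant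
  it is the dilogarithm term -Li2(-exp u)), so everything below uses only its derivative.\<close>

lemma softplus_antiderivative:
  obtains H :: "real \<Rightarrow> real"
  where "\<And>u. (H has_real_derivative ln (1 + exp u)) (at u)"
proof -
  have "isCont (\<lambda>u::real. ln (1 + exp u)) x" for x
    by (intro continuous_intros) (simp add: add_pos_pos less_imp_neq[THEN not_sym])
  then obtain H :: "real \<Rightarrow> real"
    where "\<forall>x. -\<infinity> < ereal x \<longrightarrow> ereal x < \<infinity> \<longrightarrow> (H has_vector_derivative ln (1 + exp x)) (at x)"
    using einterval_antiderivative[of "-\<infinity>" "\<infinity>" "\<lambda>u::real. ln (1 + exp u)"] by auto
  then show thesis
    using that by (auto simp: has_real_derivative_iff_has_vector_derivative)
qed

text \<open>Since 0 \<le> ln (1 + exp u) \<le> exp u, both \<open>H\<close> and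
  \<open>exp - H\<close> are nondecreasing. The bound makes differences of \<open>H\<close>
  negligible far to the left.\<close>

lemma softplus_antiderivative_dist_le:
  fixes H :: "real \<Rightarrow> real"
  assumes H: "\<And>u. (H has_real_derivative ln (1 + exp u)) (at u)"
  shows "\<bar>H p - H q\<bar> \<le> \<bar>exp p - exp q\<bar>"
proof (induction p q rule: linorder_wlog)
  case (le p q)
  have "H p \<le> H q"
    by (rule DERIV_nonneg_imp_nondecreasing[OF le]) (use H in force)
  moreover have "exp p - H p \<le> exp q - H q"
  proof (rule DERIV_nonneg_imp_nondecreasing[OF le])
    fix u :: real
    have "((\<lambda>u. exp u - H u) has_real_derivative exp u - ln (1 + exp u)) (at u)"
      by (intro DERIV_diff DERIV_exp H)
    then show "\<exists>d. ((\<lambda>u. exp u - H u) has_real_derivative d) (at u) \<and> 0 \<le> d"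
      using ln_add_one_self_le_self[of "exp u"] by force
  qed
  ultimately show ?case by linarith
qed (simp add: abs_minus_commute)

text \<open>As ln (1 + exp u) - ln (1 + exp (- u)) = u, the left side has derivative u. This trades
  values of \<open>H\<close> far to the right for values far to the left, and it is the source of
  the squares.\<close>

lemma softplus_antiderivative_reflect:
  fixes H :: "real \<Rightarrow> real"
  assumes H: "\<And>u. (H has_real_derivative ln (1 + exp u)) (at u)"
  shows "H u + H (- u) = u\<^sup>2 / 2 + 2 * H 0"
proof -
  have "((\<lambda>u. H u + H (- u) - u\<^sup>2 / 2) has_real_derivative 0) (at v)" for v
  proof -
    have "exp v * (1 + exp (- v)) = 1 + exp v"
      by (simp add: algebra_simps flip: exp_add)
    then have "ln (1 + exp v) = ln (exp v * (1 + exp (- v)))" by simp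
    also have "\<dots> = v + ln (1 + exp (- v))"
      by (simp add: ln_mult_pos add_pos_pos)
    finally have "ln (1 + exp v) - ln (1 + exp (- v)) - v = 0" by simp
    moreover have "((\<lambda>u. H u + H (- u) - u\<^sup>2 / 2) has_real_derivative
        ln (1 + exp v) - ln (1 + exp (- v)) - v) (at v)"
      by (auto intro!: derivative_eq_intros H DERIV_chain2[of H])
    ultimately show ?thesis by simp
  qed
  then have "H u + H (- u) - u\<^sup>2 / 2 = H 0 + H (- 0) - 0\<^sup>2 / 2"
    by (intro DERIV_isconst_all) auto
  then show ?thesis by simp
qed

lemma sum_squares_le_of_sum_softplus_le:
  fixes x y :: "'i \<Rightarrow> real"
  assumes sums: "sum x I = sum y I"
    and le: "\<And>s. (\<Sum>i\<in>I. ln (1 + exp (x i + s))) \<le> (\<Sum>i\<in>I. ln (1 + exp (y i + s)))"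
  shows "(\<Sum>i\<in>I. (x i)\<^sup>2) \<le> (\<Sum>i\<in>I. (y i)\<^sup>2)"
proof -
  obtain H :: "real \<Rightarrow> real" where H: "\<And>u. (H has_real_derivative ln (1 + exp u)) (at u)"
    using softplus_antiderivative by blast
  \<comment> \<open>\<open>D L\<close> is the integral over s in [-L, L] of the gap between the two
    sides of \<open>le\<close>; its limit as L grows will be at most
    \<open>\<Delta>\<close>.\<close>
  define D where "D L = (\<Sum>i\<in>I. H (y i + L) - H (y i - L)) - (\<Sum>i\<in>I. H (x i + L) - H (x i - L))" for L
  define C where "C = (\<Sum>i\<in>I. \<bar>exp (x i) - exp (y i)\<bar> + \<bar>exp (- x i) - exp (- y i)\<bar>)"
  define \<Delta> where "\<Delta> = ((\<Sum>i\<in>I. (y i)\<^sup>2) - (\<Sum>i\<in>I. (x i)\<^sup>2)) / 2"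
  have D_nonneg: "0 \<le> D L" if "0 \<le> L" for L
  proof -
    \<comment> \<open>\<open>D 0\<close> = 0, and the derivative of \<open>D\<close> at s is the gap
      in \<open>le\<close> at s plus the gap at -s.\<close>
    have "D 0 \<le> D L"
    proof (rule DERIV_nonneg_imp_nondecreasing[OF that])
      fix s :: real
      have deriv: "((\<lambda>s. \<Sum>i\<in>I. H (z i + s) - H (z i - s)) has_real_derivative
          (\<Sum>i\<in>I. ln (1 + exp (z i + s)) + ln (1 + exp (z i + - s)))) (at s)" for z :: "'i \<Rightarrow> real"
        by (auto intro!: derivative_eq_intros DERIV_chain2[of H, OF H])
      show "\<exists>d. (D has_real_derivative d) (at s) \<and> 0 \<le> d"
      proof (intro exI conjI)
        show "(D has_real_derivative
            (\<Sum>i\<in>I. ln (1 + exp (y i + s)) + ln (1 + exp (y i + - s)))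
            - (\<Sum>i\<in>I. ln (1 + exp (x i + s)) + ln (1 + exp (x i + - s)))) (at s)"
          unfolding D_def by (intro DERIV_diff deriv)
      qed (use le[of s] le[of "- s"] in \<open>simp add: sum.distrib\<close>)
    qed
    then show ?thesis by (simp add: D_def)
  qed
  have D_le: "D L \<le> \<Delta> + C * exp (- L)" for L
  proof -
    \<comment> \<open>Reflection is applied at the right end only; the constants
      \<open>2 * H 0\<close> cancel, and at both ends there remain differences of \<open>H\<close>
      near -L, of order exp (- L).\<close>
    have "H (y i + L) - H (y i - L) - (H (x i + L) - H (x i - L))
        \<le> ((y i)\<^sup>2 - (x i)\<^sup>2) / 2 + L * (y i - x i)
          + (\<bar>exp (x i) - exp (y i)\<bar> + \<bar>exp (- x i) - exp (- y i)\<bar>) * exp (- L)" for i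
    proof -
      have "\<bar>H (x i - L) - H (y i - L)\<bar> \<le> \<bar>exp (x i) - exp (y i)\<bar> * exp (- L)"
        using softplus_antiderivative_dist_le[OF H, of "x i - L" "y i - L"]
        by (simp add: exp_diff exp_minus abs_mult divide_inverse flip: left_diff_distrib)
      moreover have "\<bar>H (- (x i + L)) - H (- (y i + L))\<bar> \<le> \<bar>exp (- x i) - exp (- y i)\<bar> * exp (- L)"
        using softplus_antiderivative_dist_le[OF H, of "- (x i + L)" "- (y i + L)"]
        by (simp add: exp_diff exp_minus abs_mult divide_inverse flip: left_diff_distrib)
      moreover have "(y i + L)\<^sup>2 / 2 - (x i + L)\<^sup>2 / 2 = ((y i)\<^sup>2 - (x i)\<^sup>2) / 2 + L * (y i - x i)"
        by (simp add: power2_eq_square field_simps)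
      ultimately show ?thesis
        using softplus_antiderivative_reflect[OF H, of "y i + L"]
          softplus_antiderivative_reflect[OF H, of "x i + L"]
        by (simp add: distrib_right)
    qed
    then have "D L \<le> (\<Sum>i\<in>I. ((y i)\<^sup>2 - (x i)\<^sup>2) / 2 + L * (y i - x i)
          + (\<bar>exp (x i) - exp (y i)\<bar> + \<bar>exp (- x i) - exp (- y i)\<bar>) * exp (- L))"
      unfolding D_def sum_subtractf[symmetric] by (intro sum_mono) simp
    \<comment> \<open>The term linear in L would spoil the limit; equality of the sums removes
      it.\<close>
    also have "\<dots> = \<Delta> + L * (sum y I - sum x I) + C * exp (- L)"
      by (simp only: sum.distrib \<Delta>_def C_def sum_subtractf sum_distrib_left[symmetric]
          sum_distrib_right[symmetric] sum_divide_distrib[symmetric])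
    finally show ?thesis by (simp add: sums)
  qed
  have "((\<lambda>L. \<Delta> + C * exp (- L)) \<longlongrightarrow> \<Delta> + C * 0) at_top"
    by (intro tendsto_intros filterlim_compose[OF exp_at_bot filterlim_uminus_at_bot_at_top])
  moreover have "\<forall>\<^sub>F L in at_top. 0 \<le> \<Delta> + C * exp (- L)"
    using eventually_ge_at_top[of 0] by eventually_elim (meson D_nonneg D_le order_trans)
  ultimately have "0 \<le> \<Delta> + C * 0"
    by (rule tendsto_lowerbound) simp
  then show ?thesis by (simp add: \<Delta>_def)
qed

text \<open>Put x = ln a and y = ln b: equal products become equal sums, and the product inequality
  at t = exp (- s) becomes the softplus inequality at s.\<close>

theorem sum_ln_squares_le:
  fixes a b :: "'i \<Rightarrow> real"
  assumes pos: "\<And>i. i \<in> I \<Longrightarrow> 0 < a i" "\<And>i. i \<in> I \<Longrightarrow> 0 < b i"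
    and prod_eq: "prod a I = prod b I"
    and prod_le: "\<And>t. 0 < t \<Longrightarrow> (\<Prod>i\<in>I. t + a i) \<le> (\<Prod>i\<in>I. t + b i)"
  shows "(\<Sum>i\<in>I. (ln (a i))\<^sup>2) \<le> (\<Sum>i\<in>I. (ln (b i))\<^sup>2)"
proof (cases "finite I")
  case True
  show ?thesis
  proof (rule sum_squares_le_of_sum_softplus_le)
    show "(\<Sum>i\<in>I. ln (a i)) = (\<Sum>i\<in>I. ln (b i))"
      using pos prod_eq True by (metis ln_prod less_irrefl)
    fix s :: real
    \<comment> \<open>Pulling exp s out of each factor leaves the term
      \<open>real (card I) * s\<close>, which is the same for \<open>a\<close> and
      \<open>b\<close>.\<close>
    have sum_eq: "(\<Sum>i\<in>I. ln (1 + exp (ln (c i) + s)))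
        = real (card I) * s + ln (\<Prod>i\<in>I. exp (- s) + c i)"
      if c: "\<And>i. i \<in> I \<Longrightarrow> 0 < c i" for c :: "'i \<Rightarrow> real"
    proof -
      have "ln (1 + exp (ln (c i) + s)) = s + ln (exp (- s) + c i)" if "i \<in> I" for i
      proof -
        have "1 + exp (ln (c i) + s) = exp s * (exp (- s) + c i)"
          using c[OF that] by (simp add: exp_add distrib_left exp_minus)
        then show ?thesis
          using c[OF that] by (simp add: ln_mult_pos add_pos_pos)
      qed
      moreover have "ln (\<Prod>i\<in>I. exp (- s) + c i) = (\<Sum>i\<in>I. ln (exp (- s) + c i))"
        using c True by (intro ln_prod) (metis add_pos_pos exp_gt_zero less_irrefl)+
      ultimately show ?thesis
        by (simp add: sum.distrib)
    qed
    have "ln (\<Prod>i\<in>I. exp (- s) + a i) \<le> ln (\<Prod>i\<in>I. exp (- s) + b i)"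
      using prod_le[of "exp (- s)"] pos
      by (intro ln_mono prod_pos) (auto intro: add_pos_pos)
    then show "(\<Sum>i\<in>I. ln (1 + exp (ln (a i) + s))) \<le> (\<Sum>i\<in>I. ln (1 + exp (ln (b i) + s)))"
      using pos by (simp add: sum_eq)
  qed
\<comment> \<open>For infinite \<open>I\<close> both sums are 0 by convention.\<close>
qed simp

theorem corollary3p8:
  fixes a1 a2 a3 a4 b1 b2 b3 b4 :: real
  assumes "a1 > 0" and "a2 > 0" and "a3 > 0" and "a4 > 0"
    and "b1 > 0" and "b2 > 0" and "b3 > 0" and "b4 > 0"
    and "a1 + a2 + a3 + a4 \<le> b1 + b2 + b3 + b4"
    and "a1 * a2 + a1 * a3 + a2 * a3 + a1 * a4 + a2 * a4 + a3 * a4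
      \<le> b1 * b2 + b1 * b3 + b2 * b3 + b1 * b4 + b2 * b4 + b3 * b4"
    and "a1 * a2 * a3 + a1 * a2 * a4 + a2 * a3 * a4 + a1 * a3 * a4
      \<le> b1 * b2 * b3 + b1 * b2 * b4 + b2 * b3 * b4 + b1 * b3 * b4"
    and "a1 * a2 * a3 * a4 = b1 * b2 * b3 * b4"
  shows "(ln a1)\<^sup>2 + (ln a2)\<^sup>2 + (ln a3)\<^sup>2 + (ln a4)\<^sup>2
      \<le> (ln b1)\<^sup>2 + (ln b2)\<^sup>2 + (ln b3)\<^sup>2 + (ln b4)\<^sup>2"
proof -
  define a where "a = (!) [a1, a2, a3, a4]"
  define b where "b = (!) [b1, b2, b3, b4]"
  have "(\<Sum>i<4. (ln (a i))\<^sup>2) \<le> (\<Sum>i<4. (ln (b i))\<^sup>2)"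
  proof (rule sum_ln_squares_le)
    fix t :: real
    assume "0 < t"
    \<comment> \<open>The coefficients of the powers of t are the elementary symmetric polynomials,
      which the hypotheses compare one by one; t > 0 preserves each comparison.\<close>
    have expand: "(t + c1) * (t + c2) * (t + c3) * (t + c4) = t ^ 4 + t ^ 3 * (c1 + c2 + c3 + c4)
        + t\<^sup>2 * (c1 * c2 + c1 * c3 + c2 * c3 + c1 * c4 + c2 * c4 + c3 * c4)
        + t * (c1 * c2 * c3 + c1 * c2 * c4 + c2 * c3 * c4 + c1 * c3 * c4)
        + c1 * c2 * c3 * c4" for c1 c2 c3 c4
      by algebra
    have "(t + a1) * (t + a2) * (t + a3) * (t + a4) \<le> (t + b1) * (t + b2) * (t + b3) * (t + b4)"
      unfolding expand using \<open>0 < t\<close>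
      by (intro add_mono mult_left_mono[OF assms(9)] mult_left_mono[OF assms(10)]
          mult_left_mono[OF assms(11)] order_refl eq_refl[OF assms(12)]) auto
    then show "(\<Prod>i<4. t + a i) \<le> (\<Prod>i<4. t + b i)"
      by (simp add: a_def b_def eval_nat_numeral mult_ac)
  qed (use assms in \<open>auto simp: a_def b_def eval_nat_numeral less_Suc_eq\<close>)
  then show ?thesis
    by (simp add: a_def b_def eval_nat_numeral)
qed

end
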